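(* Let $k\ge 3$ and let $W_k$ be the regular $k$-gon in $\mathbb{R}^2$ centered at $\mathbf{0}$ with radius $1$, with vertices $\mathbf{u}_1,\dots,\mathbf{u}_k$ ordered so that $\theta_k(\mathbf{u}_i)=\mathbf{u}_{i+1 \bmod k}$. Let $T$ be a nice triangulation of $W_k$. Suppose every vertex $\mathbf{x}$ of $T$ has a label $\lambda(\mathbf{x})\in\mathbb{Z}_k$ such that $\lambda(\theta_k(\mathbf{y}))=\lambda(\mathbf{y})+1 \pmod k$ for every vertex $\mathbf{y}$ of $T$ lying on $\partial W_k$. Then at least one of the following exists: (1) a triangle of $T$ with vertices $\mathbf{v}_1,\mathbf{v}_2,\mathbf{v}_3$ whose labels $\lambda(\mathbf{v}_1),\lambda(\mathbf{v}_2),\lambda(\mathbf{v}_3)$ are pairwise distinct; or (2) an edge of $T$ with endpoints $\mathbf{v}_1,\mathbf{v}_2$ such that $\lambda(\mathbf{v}_1)-\lambda(\mathbf{v}_2) \pmod k\notin\{0,1,-1\}$.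
   Context: $\theta_k$ denotes clockwise rotation of $\mathbb{R}^2$ about the origin by angle $2\pi/k$. Let $T^\star$ be the triangulation of $W_k$ consisting of the triangles $\sigma_i=\mathrm{conv}\{\mathbf{0},\mathbf{u}_i,\mathbf{u}_{i+1 \bmod k}\}$, $i\in[k]$, and their faces. A triangulation $T$ of $W_k$ is nice if (i) it refines $T^\star$ (every simplex of $T$ is contained in a simplex of $T^\star$), and (ii) it is symmetric with respect to $\theta_k$ on the boundary: for every edge $\psi$ of $T$ with $\psi\subseteq\partial W_k$, $\theta_k(\psi)$ is also an edge of $T$. *)

theory Defs
  imports "HOL-Analysis.Analysis"
begin

definition rot :: "nat \<Rightarrow> real^2 \<Rightarrow> real^2" where
  "rot k x = vector
     [ cos (2 * pi / real k) * x $ 1 + sin (2 * pi / real k) * x $ 2,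
      - sin (2 * pi / real k) * x $ 1 + cos (2 * pi / real k) * x $ 2]"

text \<open>Indices range over \<open>{1..k}\<close>, so the cyclic successor of \<open>i\<close> is \<open>i mod k + 1\<close>.
  The position of the first vertex on the unit circle is left arbitrary.\<close>

definition regular_polygon_vertices :: "nat \<Rightarrow> (nat \<Rightarrow> real^2) \<Rightarrow> bool" where
  "regular_polygon_vertices k u \<longleftrightarrow>
     (\<forall>i\<in>{1..k}. norm (u i) = 1) \<and> (\<forall>i\<in>{1..k}. rot k (u i) = u (i mod k + 1))"

definition polygon :: "nat \<Rightarrow> (nat \<Rightarrow> real^2) \<Rightarrow> (real^2) set" where
  "polygon k u = convex hull (u ` {1..k})"

definition triangulation_of :: "(real^2) set set \<Rightarrow> (real^2) set \<Rightarrow> bool" where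
  "triangulation_of T W \<longleftrightarrow> simplicial_complex T \<and> \<Union>T = W"

definition is_vertex :: "(real^2) set set \<Rightarrow> real^2 \<Rightarrow> bool" where
  "is_vertex T x \<longleftrightarrow> {x} \<in> T"

definition is_edge :: "(real^2) set set \<Rightarrow> (real^2) set \<Rightarrow> bool" where
  "is_edge T e \<longleftrightarrow> e \<in> T \<and> 1 simplex e"

definition is_triangle :: "(real^2) set set \<Rightarrow> (real^2) set \<Rightarrow> bool" where
  "is_triangle T t \<longleftrightarrow> t \<in> T \<and> 2 simplex t"

definition star_triangulation :: "nat \<Rightarrow> (nat \<Rightarrow> real^2) \<Rightarrow> (real^2) set set" where
  "star_triangulation k u =
     {F. \<exists>i\<in>{1..k}. F face_of (convex hull {0, u i, u (i mod k + 1)})}"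

definition nice_triangulation :: "nat \<Rightarrow> (nat \<Rightarrow> real^2) \<Rightarrow> (real^2) set set \<Rightarrow> bool" where
  "nice_triangulation k u T \<longleftrightarrow>
     triangulation_of T (polygon k u) \<and>
     (\<forall>S\<in>T. \<exists>S'\<in>star_triangulation k u. S \<subseteq> S') \<and>
     (\<forall>e. is_edge T e \<and> e \<subseteq> frontier (polygon k u) \<longrightarrow> is_edge T (rot k ` e))"

end

theory Submission
  imports Defs
begin

text \<open>
  Send a vertex with label \<open>n\<close> to the root of unity \<open>exp (2 \<pi> i n / k)\<close> and extend affinely over each
  simplex. If neither alternative holds, the labels on a simplex take at most two values, differing
  by \<open>1\<close> modulo \<open>k\<close>, so each simplex is mapped into a segment that misses \<open>0\<close>, and the resulting
  continuous map \<open>f\<close> has a logarithm \<open>g\<close> on the convex polygon. On the boundary, \<open>f\<close> intertwines the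
  rotation with multiplication by \<open>exp (2 \<pi> i / k)\<close>; as the boundary is connected, rotating a
  boundary point increases \<open>g\<close> by the constant \<open>2 \<pi> i (1 / k + n)\<close> for some integer \<open>n\<close>. After \<open>k\<close>
  rotations \<open>g\<close> returns to its initial value, whence \<open>1 + k n = 0\<close>, which is absurd.
\<close>

section \<open>Topological obstruction from a continuous logarithm\<close>

lemma no_nonvanishing_equivariant_extension:
  fixes f :: "'a::real_normed_vector \<Rightarrow> complex" and h :: "'a \<Rightarrow> 'a"
  assumes "contractible W" "continuous_on W f" and nz: "\<And>x. x \<in> W \<Longrightarrow> f x \<noteq> 0"
    and K: "K \<subseteq> W" "connected K" "K \<noteq> {}"
    and h: "continuous_on K h" "h ` K \<subseteq> K" "\<And>x. x \<in> K \<Longrightarrow> (h ^^ k) x = x"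
    and eq: "\<And>x. x \<in> K \<Longrightarrow> f (h x) = cis (2 * pi / real k) * f x"
    and k: "k \<ge> 2"
  shows False
proof -
  obtain g where g: "continuous_on W g" "\<And>x. x \<in> W \<Longrightarrow> f x = exp (g x)"
    using continuous_logarithm_on_contractible assms(1-3) by metis
  \<comment> \<open>\<open>c\<close> is a logarithm of the rotation factor; \<open>d\<close>
    measures how far the increment of \<open>g\<close> along \<open>h\<close> deviates from it.
    Exponentiating kills the deviation, so \<open>d\<close> takes values in 2 pi i Z.\<close>
  define c where "c = \<i> * complex_of_real (2 * pi / real k)"
  define d where "d = (\<lambda>x. g (h x) - (g x + c))"
  have d_int: "\<exists>n::int. d x = (of_int (2 * n) * pi) * \<i>" if "x \<in> K" for x
  proof -
    have "h x \<in> W" "x \<in> W" using that K h by auto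
    then have "exp (g (h x)) = cis (2 * pi / real k) * exp (g x)"
      using eq[OF that] g(2) by metis
    also have "\<dots> = exp (g x + c)"
      by (simp add: c_def cis_conv_exp exp_add)
    finally show ?thesis
      unfolding d_def exp_eq by (auto simp: algebra_simps)
  qed
  have cont: "continuous_on K d"
    unfolding d_def
    by (intro continuous_intros continuous_on_compose2[OF g(1) h(1)] continuous_on_subset[OF g(1)])
      (use K h in auto)
  have "d constant_on K"
  proof (rule continuous_discrete_range_constant[OF K(2) cont])
    fix x assume x: "x \<in> K"
    show "\<exists>e>0. \<forall>y. y \<in> K \<and> d y \<noteq> d x \<longrightarrow> e \<le> norm (d y - d x)"
    \<comment> \<open>Distinct values of \<open>d\<close> differ by a nonzero integer multiple of 2
      pi i, so 2 pi is a uniform gap.\<close>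
    proof (intro exI[of _ "2 * pi"] conjI allI impI)
      fix y assume y: "y \<in> K \<and> d y \<noteq> d x"
      obtain m n :: int where mn: "d x = (of_int (2 * m) * pi) * \<i>" "d y = (of_int (2 * n) * pi) * \<i>"
        using d_int x y by blast
      then have "n \<noteq> m" using y by auto
      then have "1 \<le> \<bar>real_of_int (n - m)\<bar>" by linarith
      moreover have "d y - d x = of_real (2 * pi * real_of_int (n - m)) * \<i>"
        using mn by (simp add: algebra_simps)
      then have "norm (d y - d x) = 2 * pi * \<bar>real_of_int (n - m)\<bar>"
        by (simp add: norm_mult abs_mult del: of_real_mult of_int_diff)
      ultimately show "2 * pi \<le> norm (d y - d x)" by simp
    qed simp
  qed
  then obtain c0 where c0: "\<And>x. x \<in> K \<Longrightarrow> d x = c0" unfolding constant_on_def by auto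
  obtain x where x: "x \<in> K" using K by auto
  obtain n :: int where n: "c0 = (of_int (2 * n) * pi) * \<i>" using d_int[OF x] c0[OF x] by auto
  have iter: "(h ^^ j) x \<in> K \<and> g ((h ^^ j) x) = g x + of_nat j * (c + c0)" for j
  proof (induction j)
    case (Suc j)
    have "d ((h ^^ j) x) = c0" using Suc c0 by blast
    then have "g ((h ^^ Suc j) x) = g ((h ^^ j) x) + (c + c0)" by (simp add: d_def algebra_simps)
    then show ?case using Suc h(2) by (auto simp: algebra_simps)
  qed (use x in auto)
  \<comment> \<open>At \<open>j = k\<close> the orbit closes, so \<open>k\<close> times the
    increment \<open>c + c0\<close> vanishes.\<close>
  from iter[of k] h(3)[OF x] k have "c + c0 = 0" by simp
  then have "\<i> * of_real (2 * pi * (1 / real k + of_int n)) = 0"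
    by (simp add: c_def n algebra_simps)
  then have "1 / real k + of_int n = 0" by (simp del: of_real_add)
  then have "real_of_int (1 + int k * n) = 0" using k by (simp add: field_simps)
  then have "1 + int k * n = 0" by linarith
  then have "int k dvd 1" by (metis add_eq_0_iff dvd_minus_iff dvd_triv_left)
  then show False using k by simp
qed

section \<open>Affine extension over a simplicial complex\<close>

text \<open>Differences from a base point \<open>a\<close> of \<open>C\<close> are linearly
  independent, so a linear map can be prescribed on them; the constant \<open>b\<close> then adjusts
  the value at \<open>a\<close>.\<close>

lemma affine_independent_interpolation:
  fixes C :: "'a::euclidean_space set" and p :: "'a \<Rightarrow> 'b::real_vector"
  assumes "\<not> affine_dependent C"
  shows "\<exists>A b. linear A \<and> (\<forall>v\<in>C. A v + b = p v)"
proof (cases "C = {}")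
  case True
  then show ?thesis using linear_zero by blast
next
  case False
  then obtain a where a: "a \<in> C" by blast
  then have "independent ((\<lambda>x. -a + x) ` (C - {a}))"
    using assms affine_dependent_iff_dependent2 by blast
  then obtain A where A: "linear A" "\<forall>y\<in>(\<lambda>x. -a + x) ` (C - {a}). A y = p (a + y) - p a"
    using linear_independent_extend[of _ "\<lambda>y. p (a + y) - p a"] by blast
  have "A v + (p a - A a) = p v" if "v \<in> C" for v
  proof (cases "v = a")
    case False
    then have "A (-a + v) = p v - p a" using A(2) that by force
    then show ?thesis using linear_diff[OF A(1), of v a] by (simp add: algebra_simps)
  qed simp
  then show ?thesis using A(1) by blast
qed

text \<open>The set where two affine maps agree is convex, so it contains the hull of any set of
  points of agreement.\<close>

lemma affine_maps_eq_on_convex_hull: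
  assumes "linear A" "linear A'" "\<And>v. v \<in> C \<Longrightarrow> A v + b = A' v + b'" "x \<in> convex hull C"
  shows "A x + b = A' x + b'"
proof -
  have "convex {x. A x + b = A' x + b'}"
  proof (rule convexI)
    fix x y and s t :: real
    assume xy: "x \<in> {x. A x + b = A' x + b'}" "y \<in> {x. A x + b = A' x + b'}" and st: "s + t = 1"
    have split: "B (s *\<^sub>R x + t *\<^sub>R y) + z = s *\<^sub>R (B x + z) + t *\<^sub>R (B y + z)" if "linear B" for B z
    proof -
      have "z = s *\<^sub>R z + t *\<^sub>R z" by (metis scaleR_add_left scaleR_one st)
      then show ?thesis
        by (simp add: linear_add[OF that] linear_scale[OF that] algebra_simps)
    qed
    show "s *\<^sub>R x + t *\<^sub>R y \<in> {x. A x + b = A' x + b'}"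
      using xy split[OF assms(1)] split[OF assms(2)] by simp
  qed
  then have "convex hull C \<subseteq> {x. A x + b = A' x + b'}"
    by (intro hull_minimal) (use assms in auto)
  then show ?thesis using assms(4) by blast
qed

lemma simplicial_complexD:
  assumes "simplicial_complex T"
  shows "finite T" "S \<in> T \<Longrightarrow> \<exists>n. n simplex S" "S \<in> T \<Longrightarrow> F face_of S \<Longrightarrow> F \<in> T"
    "S \<in> T \<Longrightarrow> S' \<in> T \<Longrightarrow> S \<inter> S' face_of S"
  using assms unfolding simplicial_complex_def by blast+

text \<open>Interpolate on each simplex separately. Two simplices meet in a common face, whose
  extreme points are extreme in both, so the pieces agree there and can be pasted along finitely
  many closed sets.\<close>

lemma simplicial_complex_affine_extension:
  fixes T :: "'a::euclidean_space set set" and p :: "'a \<Rightarrow> 'b::real_normed_vector"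
  assumes T: "simplicial_complex T"
  obtains f where "continuous_on (\<Union>T) f" "\<And>v. {v} \<in> T \<Longrightarrow> f v = p v"
    "\<And>S. S \<in> T \<Longrightarrow> \<exists>A b. linear A \<and> (\<forall>x\<in>S. f x = A x + b)"
proof -
  note TD = simplicial_complexD[OF T]
  have "\<exists>A b. linear A \<and> (\<forall>v. v extreme_point_of S \<longrightarrow> A v + b = p v)" if "S \<in> T" for S
  proof -
    obtain C where "\<not> affine_dependent C" "S = convex hull C"
      using TD(2)[OF \<open>S \<in> T\<close>] unfolding simplex_def by blast
    then show ?thesis
      using affine_independent_interpolation[of C p] extreme_point_of_convex_hull_affine_independent[of C]
      by metis
  qed
  then obtain A b where Ab: "\<And>S. S \<in> T \<Longrightarrow> linear (A S)"
      "\<And>S v. S \<in> T \<Longrightarrow> v extreme_point_of S \<Longrightarrow> A S v + b S = p v"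
    by metis
  \<comment> \<open>The choice of simplex is harmless: \<open>agree\<close> shows that all simplices
    through \<open>x\<close> give the same value.\<close>
  define f where "f x = (let S = SOME S. S \<in> T \<and> x \<in> S in A S x + b S)" for x
  have agree: "A S x + b S = A S' x + b S'" if "S \<in> T" "S' \<in> T" "x \<in> S" "x \<in> S'" for S S' x
  proof (rule affine_maps_eq_on_convex_hull[OF Ab(1)[OF that(1)] Ab(1)[OF that(2)]])
    have face: "S \<inter> S' face_of S" "S \<inter> S' face_of S'"
      using TD(4) that by (simp, metis inf_commute that(1,2) TD(4))
    then have "S \<inter> S' \<in> T" using TD(3) that by blast
    then have "compact (S \<inter> S')" "convex (S \<inter> S')"
      using TD(2) compact_simplex convex_simplex by blast+
    \<comment> \<open>By Krein-Milman the common face is the hull of its extreme points, which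
      reduces agreement to vertices.\<close>
    then have "S \<inter> S' = convex hull {v. v extreme_point_of (S \<inter> S')}"
      by (rule Krein_Milman_Minkowski)
    then show "x \<in> convex hull {v. v extreme_point_of (S \<inter> S')}" using that by blast
    show "A S v + b S = A S' v + b S'" if "v \<in> {v. v extreme_point_of (S \<inter> S')}" for v
      using that face \<open>S \<in> T\<close> \<open>S' \<in> T\<close> extreme_point_of_face Ab(2) by (metis mem_Collect_eq)
  qed
  have f_eq: "f x = A S x + b S" if "S \<in> T" "x \<in> S" for S x
  proof -
    have "(SOME S. S \<in> T \<and> x \<in> S) \<in> T \<and> x \<in> (SOME S. S \<in> T \<and> x \<in> S)"
      by (rule someI[of _ S]) (use that in blast)
    then show ?thesis unfolding f_def Let_def using agree that by blast
  qed
  show thesis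
  proof
    have "continuous_on (\<Union>S\<in>T. S) f"
    proof (rule continuous_on_closed_Union[OF TD(1)])
      fix S assume S: "S \<in> T"
      show "closed S" using S TD(2) closed_simplex by blast
      have "continuous_on S (\<lambda>x. A S x + b S)"
        using Ab(1)[OF S] by (intro continuous_intros linear_continuous_on linear_conv_bounded_linear[THEN iffD1])
      then show "continuous_on S f" using f_eq S by (metis (no_types, lifting) continuous_on_cong)
    qed
    then show "continuous_on (\<Union>T) f" by simp
    show "f v = p v" if "{v} \<in> T" for v
      using f_eq[OF that] Ab(2)[OF that] by simp
    show "\<exists>A b. linear A \<and> (\<forall>x\<in>S. f x = A x + b)" if "S \<in> T" for S
      using f_eq that Ab(1) by blast
  qed
qed

section \<open>Simplices through a boundary point\<close>

text \<open>A simplex of least dimension through \<open>x\<close> works: a point of its relative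
  frontier would lie in a proper face, which has smaller dimension and also belongs to
  \<open>T\<close>.\<close>

lemma simplicial_complex_rel_interior:
  assumes "simplicial_complex T" "x \<in> \<Union>T"
  obtains S where "S \<in> T" "x \<in> rel_interior S"
proof -
  note TD = simplicial_complexD[OF assms(1)]
  have "finite {S\<in>T. x \<in> S}" "{S\<in>T. x \<in> S} \<noteq> {}"
    using TD(1) assms(2) by auto
  then obtain S where S: "S \<in> T" "x \<in> S" and min: "\<And>S'. S' \<in> T \<Longrightarrow> x \<in> S' \<Longrightarrow> aff_dim S \<le> aff_dim S'"
    using arg_min_if_finite[of "{S\<in>T. x \<in> S}" aff_dim] by (metis (mono_tags, lifting) linorder_not_less mem_Collect_eq)
  obtain n where n: "n simplex S" using TD(2) S by blast
  have "x \<in> rel_interior S"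
  proof (rule ccontr)
    assume "x \<notin> rel_interior S"
    then have "x \<in> rel_frontier S"
      using S closed_simplex[OF n] by (simp add: rel_frontier_def)
    then obtain F where "F face_of S" "F \<noteq> S" "x \<in> F"
      using rel_frontier_of_polyhedron_alt[OF simplex_imp_polyhedron[OF n]] by auto
    then show False
      using min[of F] TD(3) S face_of_aff_dim_lt[OF convex_simplex[OF n]] by fastforce
  qed
  then show thesis using that S by blast
qed

text \<open>A segment from \<open>y\<close> in \<open>S\<close> to \<open>x\<close> can be prolonged
  a little beyond \<open>x\<close> inside \<open>S\<close>. If \<open>y\<close> were interior to
  \<open>W\<close>, then \<open>x\<close>, strictly between \<open>y\<close> and a point of
  \<open>W\<close>, would be interior too. A full-dimensional \<open>S\<close> would have
  \<open>x\<close> in its interior, hence in that of \<open>W\<close>.\<close>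

lemma rel_interior_meets_frontier:
  fixes S W :: "'a::euclidean_space set"
  assumes "convex S" "convex W" "closed W" "S \<subseteq> W" "x \<in> rel_interior S" "x \<in> frontier W"
  shows "S \<subseteq> frontier W" "aff_dim S < int DIM('a)"
proof -
  have nint: "x \<notin> interior W" using assms by (simp add: frontier_def)
  show "S \<subseteq> frontier W"
  proof
    fix y assume y: "y \<in> S"
    have "y \<notin> interior W"
    proof
      assume yi: "y \<in> interior W"
      obtain e where e: "e > 1" "(1 - e) *\<^sub>R y + e *\<^sub>R x \<in> S"
        using convex_rel_interior_iff[of S x] assms y by auto
      define z where "z = (1 - e) *\<^sub>R y + e *\<^sub>R x"
      have "x = (1 - 1/e) *\<^sub>R y + (1/e) *\<^sub>R z"
        using e by (simp add: z_def algebra_simps divide_simps flip: scaleR_add_left)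
      moreover have "y \<noteq> z"
      proof
        assume "y = z"
        then have "e *\<^sub>R (x - y) = 0" by (auto simp: z_def algebra_simps)
        then show False using e yi nint by auto
      qed
      ultimately have "x \<in> open_segment y z"
        using e by (auto simp: in_segment intro!: exI[of _ "1/e"])
      moreover have "z \<in> closure W" using e assms closure_subset z_def by blast
      ultimately show False
        using in_interior_closure_convex_segment[OF assms(2) yi] nint by blast
    qed
    then show "y \<in> frontier W" using y assms by (auto simp: frontier_def)
  qed
  show "aff_dim S < int DIM('a)"
  proof (rule ccontr)
    assume "\<not> ?thesis"
    then have "aff_dim S = int DIM('a)" using aff_dim_le_DIM[of S] by linarith
    then have "x \<in> interior S" using assms interior_rel_interior by blast
    then show False using nint interior_mono[OF assms(4)] by blast
  qed
qed

text \<open>With empty interior, \<open>W\<close> is its own frontier. Otherwise \<open>W\<close> is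
  full-dimensional, so its frontier is its relative frontier, which for a bounded convex set is
  disconnected only in dimension 1.\<close>

lemma connected_frontier_convex:
  fixes W :: "'a::euclidean_space set"
  assumes "convex W" "compact W" "DIM('a) \<ge> 2"
  shows "connected (frontier W)"
proof (cases "interior W = {}")
  case True
  then show ?thesis
    using assms by (simp add: frontier_def compact_imp_closed convex_connected)
next
  case False
  then have "aff_dim W \<noteq> 1" using interior_rel_interior_gen[of W] assms(3) by auto
  then have "connected (rel_frontier W)"
    using assms path_connected_sphere_gen compact_imp_bounded path_connected_imp_connected by blast
  then show ?thesis using rel_frontier_nonempty_interior[OF False] by simp
qed

section \<open>The rotation and the regular polygon\<close>

lemma linear_rot: "linear (rot k)"
  by (rule linearI; simp add: rot_def vec_eq_iff forall_2 algebra_simps)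

lemma rot_funpow:
  "(rot k ^^ n) x = vector
     [ cos (real n * (2 * pi / real k)) * x $ 1 + sin (real n * (2 * pi / real k)) * x $ 2,
      - sin (real n * (2 * pi / real k)) * x $ 1 + cos (real n * (2 * pi / real k)) * x $ 2]"
proof (induction n)
  case 0
  show ?case by (simp add: vec_eq_iff forall_2)
next
  case (Suc n)
  have "real (Suc n) * t = t + real n * t" for t by (simp add: algebra_simps)
  then show ?case
    unfolding funpow.simps o_apply Suc
    by (simp only: cos_add sin_add) (simp add: rot_def vec_eq_iff forall_2 algebra_simps)
qed

lemma rot_funpow_self: "k > 0 \<Longrightarrow> (rot k ^^ k) x = x"
  by (simp add: rot_funpow vec_eq_iff forall_2)

text \<open>The inverse is the power with exponent \<open>k - 1\<close>.\<close>

lemma bij_rot: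
  assumes k: "k > 0"
  shows "bij (rot k)"
proof -
  obtain j where j: "k = Suc j" using gr0_implies_Suc[OF k] by blast
  have "rot k ((rot k ^^ j) x) = x" for x
    using rot_funpow_self[OF k, of x] by (simp add: j)
  moreover have "(rot k ^^ j) (rot k x) = x" for x
    using rot_funpow_self[OF k, of x] by (metis j funpow_swap1 funpow.simps(2) o_apply)
  ultimately show ?thesis by (intro o_bij[of "rot k ^^ j"]) auto
qed

text \<open>The inner product of \<open>x\<close> with its rotation by \<open>a\<close> is
  \<open>cos a\<close> times the squared norm of \<open>x\<close>. At a fixed point it is also the
  squared norm itself, and \<open>cos a < 1\<close>.\<close>

lemma rot_fixed_point:
  assumes "k \<ge> 2" "rot k x = x"
  shows "x = 0"
proof -
  define a where "a = 2 * pi / real k"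
  have a: "0 < a" "a \<le> pi" using assms by (auto simp: a_def field_simps)
  then have c: "cos a < 1" using cos_monotone_0_pi[of 0 a] by simp
  have 1: "cos a * x $ 1 + sin a * x $ 2 = x $ 1" and 2: "- sin a * x $ 1 + cos a * x $ 2 = x $ 2"
    using assms(2) by (auto simp: rot_def vec_eq_iff forall_2 a_def)
  have "cos a * ((x $ 1)\<^sup>2 + (x $ 2)\<^sup>2) =
      x $ 1 * (cos a * x $ 1 + sin a * x $ 2) + x $ 2 * (- sin a * x $ 1 + cos a * x $ 2)"
    by (simp add: algebra_simps power2_eq_square)
  also have "\<dots> = (x $ 1)\<^sup>2 + (x $ 2)\<^sup>2" unfolding 1 2 by (simp add: power2_eq_square)
  finally have "(cos a - 1) * ((x $ 1)\<^sup>2 + (x $ 2)\<^sup>2) = 0" by (simp add: algebra_simps)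
  then have "(x $ 1)\<^sup>2 + (x $ 2)\<^sup>2 = 0" using c by simp
  then show ?thesis by (simp add: vec_eq_iff forall_2 sum_power2_eq_zero_iff)
qed

lemma rot_polygon:
  assumes "k \<ge> 3" "regular_polygon_vertices k u"
  shows "rot k ` polygon k u = polygon k u"
proof -
  have "(\<lambda>i. i mod k + 1) ` {1..k} = {1..k}"
  proof (rule card_subset_eq)
    have inj: "inj_on (\<lambda>i. i mod k + 1) {1..k}"
    proof (rule inj_onI)
      fix i j assume ij: "i \<in> {1..k}" "j \<in> {1..k}" "i mod k + 1 = j mod k + 1"
      then show "i = j"
        by (cases "i = k"; cases "j = k") auto
    qed
    show "card ((\<lambda>i. i mod k + 1) ` {1..k}) = card {1..k}" using card_image[OF inj] .
  qed (use assms in \<open>auto simp: Suc_le_eq\<close>)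
  moreover have "rot k ` u ` {1..k} = u ` (\<lambda>i. i mod k + 1) ` {1..k}"
    using assms(2) by (auto simp: regular_polygon_vertices_def image_image)
  ultimately show ?thesis
    unfolding polygon_def by (metis convex_hull_linear_image linear_rot)
qed

lemma rot_frontier_polygon:
  assumes "k \<ge> 3" "regular_polygon_vertices k u"
  shows "rot k ` frontier (polygon k u) = frontier (polygon k u)"
proof -
  have b: "bij (rot k)" using bij_rot assms by simp
  have closed: "closed (polygon k u)"
    unfolding polygon_def by (intro compact_imp_closed finite_imp_compact_convex_hull) simp
  have "rot k ` interior (polygon k u) = interior (polygon k u)"
    using interior_injective_linear_image[OF linear_rot bij_is_inj[OF b], of "polygon k u"] rot_polygon[OF assms]
    by simp
  then show ?thesis
    using closed rot_polygon[OF assms] by (simp add: frontier_def image_set_diff[OF bij_is_inj[OF b]])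
qed

text \<open>The polygon lies in the closed unit disc, so its interior lies in the open disc, while
  the vertices have norm 1.\<close>

lemma polygon_vertex_in_frontier:
  assumes "regular_polygon_vertices k u" "i \<in> {1..k}"
  shows "u i \<in> frontier (polygon k u)"
proof -
  have "polygon k u \<subseteq> cball 0 1"
    unfolding polygon_def using assms(1) by (intro hull_minimal) (auto simp: regular_polygon_vertices_def)
  then have "interior (polygon k u) \<subseteq> ball 0 1" by (metis interior_mono interior_cball)
  moreover have "norm (u i) = 1" "u i \<in> polygon k u"
    using assms by (auto simp: regular_polygon_vertices_def polygon_def intro: hull_inc)
  ultimately show ?thesis
    using closure_subset by (fastforce simp: frontier_def)
qed

section \<open>Labels as roots of unity\<close>

definition root_of_label :: "nat \<Rightarrow> int \<Rightarrow> complex" where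
  "root_of_label k n = cis (2 * pi * of_int n / real k)"

lemma root_of_label_add: "root_of_label k (m + n) = root_of_label k m * root_of_label k n"
  by (simp add: root_of_label_def cis_mult algebra_simps add_divide_distrib)

lemma root_of_label_mod:
  assumes "k > 0"
  shows "root_of_label k (n mod int k) = root_of_label k n"
proof -
  have "root_of_label k (int k * q) = 1" for q
    using assms cis_multiple_2pi[of "of_int q"] by (simp add: root_of_label_def mult.assoc)
  then show ?thesis
    by (metis root_of_label_add mult_1 mult_div_mod_eq)
qed

text \<open>Dividing by one endpoint, 0 would lie on the segment from 1 to the quotient
  \<open>z\<close>. Either \<open>z = 1\<close>, or \<open>z\<close> is off the real axis because
  \<open>k >= 3\<close>; in both cases the segment misses 0.\<close>

lemma zero_notin_segment_roots:
  assumes "k \<ge> 3" "(m - n) mod int k \<in> {0, 1, (- 1) mod int k}"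
  shows "0 \<notin> closed_segment (root_of_label k m) (root_of_label k n)"
proof
  assume "0 \<in> closed_segment (root_of_label k m) (root_of_label k n)"
  then obtain t where t: "0 \<le> t" "t \<le> 1"
    "0 = (1 - t) *\<^sub>R root_of_label k m + t *\<^sub>R root_of_label k n"
    by (auto simp: in_segment)
  define z where "z = root_of_label k (m - n)"
  have z: "z \<in> {1, cis (2 * pi / real k), cis (- (2 * pi / real k))}"
  proof -
    have "z = root_of_label k ((m - n) mod int k)"
      using assms root_of_label_mod z_def by simp
    moreover have "root_of_label k ((- 1) mod int k) = root_of_label k (- 1)"
      using assms root_of_label_mod by simp
    ultimately show ?thesis using assms(2) by (auto simp: root_of_label_def)
  qed
  have nz: "root_of_label k n \<noteq> 0" by (simp add: root_of_label_def)
  have "root_of_label k m = z * root_of_label k n"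
    unfolding z_def by (metis root_of_label_add diff_add_cancel)
  then have "((1 - t) *\<^sub>R z + of_real t) * root_of_label k n = 0"
    using t(3) by (simp add: scaleR_conv_of_real algebra_simps)
  then have eq: "(1 - t) *\<^sub>R z + of_real t = 0" using nz by simp
  have "0 < 2 * pi / real k" "2 * pi / real k < pi" using assms(1) by (auto simp: field_simps)
  then have s: "sin (2 * pi / real k) > 0" by (rule sin_gt_zero)
  have im: "(1 - t) * Im z = 0" and re: "(1 - t) * Re z + t = 0"
    using arg_cong[OF eq, of Im] arg_cong[OF eq, of Re] by simp_all
  show False
  proof (cases "z = 1")
    case True
    then show False using re by simp
  next
    case False
    then have "Im z \<noteq> 0" using z s by auto
    then show False using im re by simp
  qed
qed

section \<open>Proof of the labelling theorem\<close>

lemma simplicial_complex_subsimplex: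
  assumes "simplicial_complex T" "convex hull C \<in> T" "\<not> affine_dependent C" "D \<subseteq> C"
  shows "convex hull D \<in> T" "(int (card D) - 1) simplex convex hull D"
proof -
  show "convex hull D \<in> T"
    using assms simplicial_complexD(3) face_of_convex_hull_affine_independent by blast
  show "(int (card D) - 1) simplex convex hull D"
    using affine_independent_subset[OF assms(3,4)] by (simp add: simplex_convex_hull)
qed

theorem mainTheorem2:
  fixes k :: nat and u :: "nat \<Rightarrow> real^2" and T :: "(real^2) set set"
    and lab :: "real^2 \<Rightarrow> int"
  assumes "k \<ge> 3"
    and "regular_polygon_vertices k u"
    and "nice_triangulation k u T"
    and "\<And>x. is_vertex T x \<Longrightarrow> lab x \<in> {0..<int k}"
    and "\<And>y. is_vertex T y \<Longrightarrow> y \<in> frontier (polygon k u) \<Longrightarrow>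
           lab (rot k y) = (lab y + 1) mod int k"
  shows "(\<exists>v1 v2 v3. is_triangle T (convex hull {v1, v2, v3}) \<and>
            lab v1 \<noteq> lab v2 \<and> lab v1 \<noteq> lab v3 \<and> lab v2 \<noteq> lab v3) \<or>
         (\<exists>v1 v2. is_edge T (convex hull {v1, v2}) \<and>
            (lab v1 - lab v2) mod int k \<notin> {0, 1, (- 1) mod int k})"
proof (rule ccontr)
  assume neg: "\<not> ?thesis"
  define W where "W = polygon k u"
  define K where "K = frontier W"
  define p where "p v = root_of_label k (lab v)" for v
  define \<omega> where "\<omega> = cis (2 * pi / real k)"
  have T: "simplicial_complex T" and TW: "\<Union>T = W"
    and rot_edge: "\<And>e. is_edge T e \<Longrightarrow> e \<subseteq> K \<Longrightarrow> is_edge T (rot k ` e)"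
    using assms(3) by (auto simp: nice_triangulation_def triangulation_of_def W_def K_def)
  note TD = simplicial_complexD[OF T]
  have W: "convex W" "compact W" "closed W"
    by (auto simp: W_def polygon_def finite_imp_compact_convex_hull compact_imp_closed)
  have K: "K \<subseteq> W" "connected K" "closed K"
    using W connected_frontier_convex[of W] by (auto simp: K_def frontier_subset_eq)
  have rotK: "rot k ` K = K"
    using rot_frontier_polygon assms(1,2) by (simp add: K_def W_def)
  have cont_rot: "continuous_on X (rot k)" for X
    using linear_rot by (simp add: linear_continuous_on linear_conv_bounded_linear)
  obtain f where f: "continuous_on W f" "\<And>v. {v} \<in> T \<Longrightarrow> f v = p v"
      "\<And>S. S \<in> T \<Longrightarrow> \<exists>A b. linear A \<and> (\<forall>x\<in>S. f x = A x + b)"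
    using simplicial_complex_affine_extension[OF T, of p] TW by metis
  have simplexE: "\<exists>C. \<not> affine_dependent C \<and> S = convex hull C \<and> (\<forall>v\<in>C. {v} \<in> T)"
    if "S \<in> T" for S
  proof -
    obtain C where C: "\<not> affine_dependent C" "S = convex hull C"
      using TD(2)[OF \<open>S \<in> T\<close>] unfolding simplex_def by blast
    then have "{v} \<in> T" if "v \<in> C" for v
      using simplicial_complex_subsimplex(1)[OF T _ C(1), of "{v}"] that \<open>S \<in> T\<close> by simp
    then show ?thesis using C by blast
  qed
  have nz: "f x \<noteq> 0" if "x \<in> W" for x
  proof -
    obtain S where S: "S \<in> T" "x \<in> S" using TW \<open>x \<in> W\<close> by blast
    obtain C where C: "\<not> affine_dependent C" "S = convex hull C" "\<And>v. v \<in> C \<Longrightarrow> {v} \<in> T"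
      using simplexE[OF S(1)] by blast
    note sub = simplicial_complex_subsimplex[OF T S(1)[unfolded C(2)] C(1)]
    \<comment> \<open>Any two vertices of a simplex span an edge of \<open>T\<close>, so failure of
      the second alternative constrains their labels.\<close>
    have close: "(lab v - lab w) mod int k \<in> {0, 1, (- 1) mod int k}" if "v \<in> C" "w \<in> C" for v w
    proof (cases "v = w")
      case False
      then have "is_edge T (convex hull {v, w})"
        using sub[of "{v, w}"] that by (simp add: is_edge_def)
      then show ?thesis using neg by blast
    qed simp
    obtain v where v: "v \<in> C" using S C by fastforce
    \<comment> \<open>Three distinct labels within \<open>C\<close> would give a triangle as in the
      first alternative; \<open>w = v\<close> is allowed.\<close>
    have "\<exists>w\<in>C. \<forall>y\<in>C. lab y = lab v \<or> lab y = lab w"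
    proof (rule ccontr)
      assume *: "\<not> ?thesis"
      then obtain w where w: "w \<in> C" "lab w \<noteq> lab v" using v by blast
      with * obtain y where y: "y \<in> C" "lab y \<noteq> lab v" "lab y \<noteq> lab w" by blast
      have "v \<noteq> w" "v \<noteq> y" "w \<noteq> y" using w y by auto
      then have "card {v, w, y} = 3" by simp
      then have "is_triangle T (convex hull {v, w, y})"
        using sub[of "{v, w, y}"] v w y by (simp add: is_triangle_def)
      then show False using neg w y by metis
    qed
    then obtain w where w: "w \<in> C" "\<And>y. y \<in> C \<Longrightarrow> lab y = lab v \<or> lab y = lab w" by blast
    obtain A b where A: "linear A" "\<And>x. x \<in> S \<Longrightarrow> f x = A x + b" using f(3)[OF S(1)] by blast
    have "b + A y \<in> closed_segment (p v) (p w)" if "y \<in> C" for y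
    proof -
      have "b + A y = p y"
        using A(2)[of y] f(2) C that by (simp add: hull_inc add.commute)
      then show ?thesis using w(2)[OF that] by (auto simp: p_def)
    qed
    \<comment> \<open>A segment is convex, so it contains the affine image of the whole simplex once
      it contains the vertex images.\<close>
    then have "convex hull ((+) b ` A ` C) \<subseteq> closed_segment (p v) (p w)"
      by (intro hull_minimal) auto
    moreover have "b + A x \<in> convex hull ((+) b ` A ` C)"
      using S(2) C(2) convex_hull_linear_image[OF A(1), of C] by (auto simp: convex_hull_translation)
    ultimately have "f x \<in> closed_segment (p v) (p w)"
      using A(2)[OF S(2)] by (auto simp: add.commute)
    then show ?thesis
      using zero_notin_segment_roots[OF assms(1) close[OF v w(1)]] by (auto simp: p_def)
  qed
  \<comment> \<open>Such an \<open>x\<close> lies inside a boundary edge whose rotated copy is again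
    an edge. Both sides are affine along the edge, so it suffices to compare them at its endpoints,
    where the label condition applies.\<close>
  have eq_off_vertices: "f (rot k x) = \<omega> * f x" if x: "x \<in> K" "{x} \<notin> T" for x
  proof -
    have "x \<in> \<Union>T" using TW x K by blast
    then obtain S where S: "S \<in> T" "x \<in> rel_interior S"
      using simplicial_complex_rel_interior[OF T] by blast
    then have xS: "x \<in> S" using rel_interior_subset by blast
    obtain n where n: "n simplex S" using TD(2) S by blast
    have SW: "S \<subseteq> W" using TW S(1) by blast
    have SK: "S \<subseteq> K" and "aff_dim S < int DIM(real^2)"
      using rel_interior_meets_frontier[OF convex_simplex[OF n] W(1,3) SW S(2)] x(1)
      by (auto simp: K_def)
    \<comment> \<open>A simplex in the boundary has dimension below 2; it is nonempty, and it is not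
      a point because \<open>x\<close> is no vertex. Only an edge remains.\<close>
    then have "n < 2" using aff_dim_simplex[OF n] by simp
    moreover have "n \<noteq> -1" using n xS by auto
    moreover have "n \<noteq> 0" using n xS S(1) x(2) by (auto simp: simplex_zero)
    ultimately have "n = 1" using simplex_dim_ge[OF n] by linarith
    then have edge: "is_edge T S" using n S by (simp add: is_edge_def)
    then have rS: "rot k ` S \<in> T" using rot_edge[OF edge SK] by (simp add: is_edge_def)
    obtain v w where vw: "v \<noteq> w" "S = convex hull {v, w}"
    proof -
      obtain C where "card C = 2" "S = convex hull C"
        using n \<open>n = 1\<close> by (auto simp: simplex_def)
      then show thesis using that by (auto simp: card_2_iff)
    qed
    \<comment> \<open>Endpoints are extreme points, hence faces; as \<open>rot k\<close> carries
      edge \<open>S\<close> to an edge, it carries endpoints to vertices of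
      \<open>T\<close>.\<close>
    have ends: "{y} \<in> T \<and> {rot k y} \<in> T \<and> y \<in> K" if "y \<in> {v, w}" for y
    proof -
      have "rot k ` S = closed_segment (rot k v) (rot k w)"
        using convex_hull_linear_image[OF linear_rot, of k "{v, w}"] vw by (simp add: segment_convex_hull)
      then have "{rot k y} face_of rot k ` S"
        using that by (auto simp: face_of_singleton extreme_point_of_segment)
      moreover have "{y} face_of S"
        using that vw by (auto simp: face_of_singleton extreme_point_of_convex_hull_2)
      ultimately show ?thesis using TD(3) S(1) rS SK face_of_imp_subset by blast
    qed
    obtain A b where A: "linear A" "\<And>x. x \<in> S \<Longrightarrow> f x = A x + b" using f(3)[OF S(1)] by blast
    obtain B c where B: "linear B" "\<And>x. x \<in> rot k ` S \<Longrightarrow> f x = B x + c" using f(3)[OF rS] by blast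
    have "(B \<circ> rot k) x + c = (\<lambda>y. \<omega> * A y) x + \<omega> * b"
    proof (rule affine_maps_eq_on_convex_hull[of _ "\<lambda>y. \<omega> * A y" "{v, w}"])
      show "linear (B \<circ> rot k)" using linear_compose[OF linear_rot B(1)] .
      show "linear (\<lambda>y. \<omega> * A y)"
        using linear_compose[OF A(1), of "(*) \<omega>"] linear_times by (simp add: o_def)
      show "x \<in> convex hull {v, w}" using xS vw by simp
      show "(B \<circ> rot k) y + c = \<omega> * A y + \<omega> * b" if "y \<in> {v, w}" for y
      proof -
        have yS: "y \<in> S" using that vw by (auto intro: hull_inc)
        have "lab (rot k y) = (lab y + 1) mod int k"
          using assms(5)[of y] ends[OF that] by (simp add: is_vertex_def K_def W_def)
        then have "p (rot k y) = \<omega> * p y"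
          using assms(1) root_of_label_mod[of k "lab y + 1"]
          by (simp add: p_def root_of_label_add) (simp add: root_of_label_def \<omega>_def)
        then have "f (rot k y) = \<omega> * f y" using f(2) ends[OF that] by simp
        then show ?thesis using A(2)[OF yS] B(2)[of "rot k y"] yS by (simp add: algebra_simps)
      qed
    qed
    then show ?thesis using A(2)[OF xS] B(2)[of "rot k x"] xS by (simp add: algebra_simps)
  qed
  have u1: "u 1 \<in> K" using polygon_vertex_in_frontier[OF assms(2), of 1] assms(1) by (simp add: K_def W_def)
  \<comment> \<open>A one-point boundary would be fixed by the rotation and thus be the origin,
    contradicting that \<open>u 1\<close> has norm 1.\<close>
  have nsing: "K \<noteq> {y}" for y
  proof
    assume "K = {y}"
    then have "rot k (u 1) = u 1" using u1 rotK by auto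
    then have "u 1 = 0" using rot_fixed_point[of k "u 1"] assms(1) by simp
    moreover have "norm (u 1) = 1" using assms(1,2) by (simp add: regular_polygon_vertices_def)
    ultimately show False by simp
  qed
  \<comment> \<open>Symmetry is only assumed for edges; vertices are covered because the boundary has no isolated points.\<close>
  have eq: "f (rot k x) = \<omega> * f x" if "x \<in> K" for x
  proof -
    define V where "V = {x. {x} \<in> T}"
    have "finite V"
      using finite_vimageI[OF TD(1), of "\<lambda>x. {x}"] by (simp add: V_def vimage_def)
    have "x islimpt K" using connected_imp_perfect[OF K(2) that nsing] .
    then have "x islimpt (V \<union> (K - V))" by (rule islimpt_subset) blast
    \<comment> \<open>Removing the finitely many vertices does not destroy a limit point, so the
      identity extends from \<open>K - V\<close> by continuity.\<close>
    then have "x islimpt (K - V)" using islimpt_Un_finite[OF \<open>finite V\<close>] by blast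
    then have x: "x \<in> closure (K - V)" by (simp add: closure_def)
    have "closure (K - V) \<subseteq> K" using K(3) by (simp add: closure_minimal)
    moreover have "continuous_on K (\<lambda>x. f (rot k x) - \<omega> * f x)"
      by (intro continuous_intros continuous_on_compose2[OF f(1) cont_rot] continuous_on_subset[OF f(1) K(1)])
        (use rotK K(1) in blast)
    ultimately have "continuous_on (closure (K - V)) (\<lambda>x. f (rot k x) - \<omega> * f x)"
      using continuous_on_subset by blast
    then have "f (rot k x) - \<omega> * f x = 0"
      by (rule continuous_constant_on_closure[OF _ _ x]) (use eq_off_vertices in \<open>auto simp: V_def\<close>)
    then show ?thesis by simp
  qed
  show False
  proof (rule no_nonvanishing_equivariant_extension[of W f K "rot k" k])
    show "contractible W" using W convex_imp_contractible by blast
    show "f (rot k x) = cis (2 * pi / real k) * f x" if "x \<in> K" for x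
      using eq[OF that] by (simp add: \<omega>_def)
  qed (use f nz K u1 rotK cont_rot assms(1) rot_funpow_self in auto)
qed

end
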